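(* Let $m\ge1$, $n_1,\dots,n_m\ge1$, and $\mathbb{X}=\biguplus_{r=1}^{m}\{r\}\times\mathbb{R}^{n_r}$. Suppose the posterior density on $\mathbb{X}$ at time $k-1$ is $f_{k-1|k-1}(r_{k-1},x_{k-1})=f_{k-1|k-1}(r_{k-1})f_{k-1|k-1}(x_{k-1}|r_{k-1})$ with $$f_{k-1|k-1}(x_{k-1}|r_{k-1})=\mathcal{N}\big(x_{k-1};\overline{x}_{k-1|k-1}^{(r_{k-1})},P_{k-1|k-1}^{(r_{k-1})}\big)$$ for each mode, and that the transition density is $\mu(r_k|r_{k-1})\,\pi(x_k|x_{k-1},r_k,r_{k-1})$ with $$\pi(x_k|x_{k-1},r_k,r_{k-1})=\mathcal{N}\big(x_k;F^{(r_k,r_{k-1})}x_{k-1}+b^{(r_k,r_{k-1})},Q^{(r_k,r_{k-1})}\big).$$ Then the predicted density on $\mathbb{X}$ is $f_{k|k-1}(r_k,x_k)=f_{k|k-1}(r_k)f_{k|k-1}(x_k|r_k)$, where the state density given each mode is the Gaussian mixture $$f_{k|k-1}(x_k|r_k)=\sum_{r_{k-1}=1}^{m}\alpha_{k|k-1}^{(r_k,r_{k-1})}\,\mathcal{N}\big(x_k;\overline{x}_{k|k-1}^{(r_k,r_{k-1})},P_{k|k-1}^{(r_k,r_{k-1})}\big)$$ with parameters $$\overline{x}_{k|k-1}^{(r_k,r_{k-1})}=F^{(r_k,r_{k-1})}\overline{x}_{k-1|k-1}^{(r_{k-1})}+b^{(r_k,r_{k-1})},$$ $$P_{k|k-1}^{(r_k,r_{k-1})}=F^{(r_k,r_{k-1})}P_{k-1|k-1}^{(r_{k-1})}\big(F^{(r_k,r_{k-1})}\big)^{T}+Q^{(r_k,r_{k-1})},$$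 $$\alpha_{k|k-1}^{(r_k,r_{k-1})}=\frac{\mu(r_k|r_{k-1})f_{k-1|k-1}(r_{k-1})}{\sum_{r'=1}^{m}\mu(r_k|r')f_{k-1|k-1}(r')},$$ and the predicted density of the mode is $f_{k|k-1}(r_k)=\sum_{r_{k-1}=1}^{m}\mu(r_k|r_{k-1})f_{k-1|k-1}(r_{k-1})$.
   Context: The target state is $\tilde x=(r,x)\in\mathbb{X}$ with mode $r\in\{1,\dots,m\}$ and kinematic state $x\in\mathbb{R}^{n_r}$; the dimensions $n_r$ may differ between modes. The integral of a function $g$ on $\mathbb{X}$ is $\int_{\mathbb{X}}g(\tilde x)\,d\tilde x=\sum_{r=1}^m\int_{\mathbb{R}^{n_r}}g(r,x)\,dx$. A density on $\mathbb{X}$ is a nonnegative function with integral one; $g(r)=\int g(r,x)\,dx$ is its mode marginal and $g(x|r)=g(r,x)/g(r)$ the conditional density of the state given the mode (formulas conditioned on $r_k$ are asserted for modes with $f_{k|k-1}(r_k)>0$). $\mathcal{N}(x;\bar x,P)$ denotes the Gaussian density with mean $\bar x$ and covariance matrix $P$ (symmetric positive definite) evaluated at $x$. $\mu(\cdot|r_{k-1})$ is a probability mass function on $\{1,\dots,m\}$; $F^{(r_k,r_{k-1})}\in\mathbb{R}^{n_{r_k}\times n_{r_{k-1}}}$, $b^{(r_k,r_{k-1})}\in\mathbb{R}^{n_{r_k}}$, $Q^{(r_k,r_{k-1})}\in\mathbb{R}^{n_{r_k}\times n_{r_k}}$. The predicted density is given by the Chapman–Kolmogorov equation on $\mathbb{X}$: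 $f_{k|k-1}(r_k,x_k)=\sum_{r_{k-1}=1}^m\int_{\mathbb{R}^{n_{r_{k-1}}}} \mu(r_k|r_{k-1})\pi(x_k|x_{k-1},r_k,r_{k-1})f_{k-1|k-1}(r_{k-1},x_{k-1})\,dx_{k-1}$. *)

theory Defs
  imports
    "HOL-Probability.Probability"
    "Jordan_Normal_Form.Determinant"
    "Jordan_Normal_Form.Gauss_Jordan_Elimination"
begin

text \<open>
  The dimension of the kinematic state depends on the mode, so it cannot be a type parameter:
  vectors and matrices carry their dimensions as explicit carrier sets.
\<close>

type_synonym rvec = "real Matrix.vec"
type_synonym rmat = "real Matrix.mat"

text \<open>
  Lebesgue measure (on the Borel sets) of \<open>\<real>\<^sup>n\<close> with underlying set \<open>carrier_vec n\<close>: the \<open>n\<close>-fold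
  product of \<^const>\<open>lborel\<close>, transported along the bijection that turns an extensional function on
  \<open>{..<n}\<close> into a vector.
\<close>

definition lborel_vec :: "nat \<Rightarrow> rvec measure" where
  "lborel_vec n = embed_measure (PiM {..<n} (\<lambda>_. lborel)) (Matrix.vec n)"

lemma space_lborel_vec: "space (lborel_vec n) = carrier_vec n"
proof -
  have "v \<in> Matrix.vec n ` (\<Pi>\<^sub>E i\<in>{..<n}. UNIV)" if "v \<in> carrier_vec n" for v :: rvec
    by (rule image_eqI[of _ _ "restrict (vec_index v) {..<n}"]) (use that in auto)
  then show ?thesis
    by (auto simp: lborel_vec_def space_embed_measure space_PiM)
qed

definition sym_pos_def :: "nat \<Rightarrow> rmat \<Rightarrow> bool" where
  "sym_pos_def n P \<longleftrightarrow>
     P \<in> carrier_mat n n \<and> transpose_mat P = P \<and>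
     (\<forall>v\<in>carrier_vec n. v \<noteq> 0\<^sub>v n \<longrightarrow> 0 < scalar_prod v (P *\<^sub>v v))"

definition gaussian :: "rvec \<Rightarrow> rvec \<Rightarrow> rmat \<Rightarrow> real" where
  "gaussian x xbar P =
     exp (- (1 / 2) * scalar_prod (x - xbar) (the (mat_inverse P) *\<^sub>v (x - xbar)))
       / sqrt ((2 * pi) ^ dim_row P * Determinant.det P)"

text \<open>
  Functions on the hybrid state space are functions of pairs \<open>(r, x)\<close> with mode
  \<open>r \<in> {1..m}\<close> and \<open>x \<in> carrier_vec (n r)\<close>.
\<close>

definition hybrid_space :: "nat \<Rightarrow> (nat \<Rightarrow> nat) \<Rightarrow> (nat \<times> rvec) set" where
  "hybrid_space m n = (SIGMA r:{1..m}. carrier_vec (n r))"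

definition hybrid_integral :: "nat \<Rightarrow> (nat \<Rightarrow> nat) \<Rightarrow> (nat \<times> rvec \<Rightarrow> real) \<Rightarrow> real" where
  "hybrid_integral m n g = (\<Sum>r=1..m. \<integral>x. g (r, x) \<partial>lborel_vec (n r))"

definition hybrid_density :: "nat \<Rightarrow> (nat \<Rightarrow> nat) \<Rightarrow> (nat \<times> rvec \<Rightarrow> real) \<Rightarrow> bool" where
  "hybrid_density m n g \<longleftrightarrow>
     (\<forall>z\<in>hybrid_space m n. 0 \<le> g z) \<and>
     (\<forall>r\<in>{1..m}. integrable (lborel_vec (n r)) (\<lambda>x. g (r, x))) \<and>
     hybrid_integral m n g = 1"

definition mode_marginal :: "(nat \<Rightarrow> nat) \<Rightarrow> (nat \<times> rvec \<Rightarrow> real) \<Rightarrow> nat \<Rightarrow> real" where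
  "mode_marginal n g r = (\<integral>x. g (r, x) \<partial>lborel_vec (n r))"

text \<open>Only meaningful for modes of positive marginal probability.\<close>

definition state_conditional ::
    "(nat \<Rightarrow> nat) \<Rightarrow> (nat \<times> rvec \<Rightarrow> real) \<Rightarrow> rvec \<Rightarrow> nat \<Rightarrow> real" where
  "state_conditional n g x r = g (r, x) / mode_marginal n g r"

text \<open>
  The Chapman--Kolmogorov equation. The mode transition probability from \<open>s\<close> to \<open>r\<close> is
  \<open>pmf (\<mu> s) r\<close>, and \<open>\<pi> x y r s\<close> is the density of the new state \<open>x\<close> given the old state \<open>y\<close>,
  the new mode \<open>r\<close> and the old mode \<open>s\<close>.
\<close>

definition predicted_density ::
    "nat \<Rightarrow> (nat \<Rightarrow> nat) \<Rightarrow> (nat \<Rightarrow> nat pmf) \<Rightarrow> (rvec \<Rightarrow> rvec \<Rightarrow> nat \<Rightarrow> nat \<Rightarrow> real) \<Rightarrow>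
      (nat \<times> rvec \<Rightarrow> real) \<Rightarrow> nat \<times> rvec \<Rightarrow> real" where
  "predicted_density m n \<mu> \<pi> f = (\<lambda>(r, x).
     \<Sum>s=1..m. \<integral>y. pmf (\<mu> s) r * \<pi> x y r s * f (s, y) \<partial>lborel_vec (n s))"

end

theory Submission
  imports Defs
begin

text \<open>
  The Gaussian integral over \<open>\<real>\<^sup>n\<close> follows by induction on \<open>n\<close>: integrating out the last coordinate
  replaces the matrix by the Schur complement of its last diagonal entry. Completing the square in
  the old state and using \<open>det (F P F\<^sup>T + Q) = det Q det P det (P\<^sup>-\<^sup>1 + F\<^sup>T Q\<^sup>-\<^sup>1 F)\<close> then gives the
  Chapman--Kolmogorov integral of two Gaussians. A mode of zero probability contributes nothing,
  because the posterior vanishes almost everywhere there.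
\<close>

text \<open>Peeling off one coordinate at a time matches the product structure of
  \<open>lborel_vec\<close> and avoids diagonalisation and linear changes of variables. It works
  because the quadratic form and the determinant pass to the same Schur complement, so one induction
  yields both the value of the integral and the positivity of the determinant under the square root.
  The matrix \<open>F\<close> is rectangular and of arbitrary rank, so \<open>F *\<^sub>v y\<close>
  cannot serve as an integration variable. The integral is therefore taken in the old state itself,
  whose precision matrix P^-1 + F^T Q^-1 F is positive definite because P^-1 is, whatever the kernel
  of \<open>F\<close>. The value then emerges with three determinants, and the determinant identity
  is what merges them into the normaliser of a single Gaussian.\<close>

section \<open>Block determinants and Schur complements\<close>

lemma minus_add_cancel_mat:
  fixes A B :: "'a :: group_add mat"
  shows "A \<in> carrier_mat n k \<Longrightarrow> B \<in> carrier_mat n k \<Longrightarrow> A - B + B = A"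
  by (intro eq_matI) auto

text \<open>Since \<open>B * E * D = B\<close>, a unit upper triangular factor with corner
  \<open>B * E\<close> can be split off on the left. What remains is block lower triangular with
  \<open>A - B * E * C\<close> and \<open>D\<close> on the diagonal.\<close>

lemma det_four_block_mat_schur_lower_right:
  fixes A B C D E :: "'a :: idom mat"
  assumes A: "A \<in> carrier_mat n n" and B: "B \<in> carrier_mat n k"
    and C: "C \<in> carrier_mat k n" and D: "D \<in> carrier_mat k k"
    and E: "E \<in> carrier_mat k k" "E * D = 1\<^sub>m k"
  shows "Determinant.det (four_block_mat A B C D) =
    Determinant.det (A - B * E * C) * Determinant.det D"
proof -
  have BE: "B * E \<in> carrier_mat n k" and BEC: "B * E * C \<in> carrier_mat n n"
    using A B C E by auto
  have S: "A - B * E * C \<in> carrier_mat n n"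
    using BEC by (rule minus_carrier_mat)
  have "B * E * D = B"
    using assoc_mult_mat[OF B E(1) D] B by (simp add: E(2))
  moreover have "A - B * E * C + B * E * C = A"
    using A BEC by (rule minus_add_cancel_mat)
  ultimately have "four_block_mat A B C D =
      four_block_mat (1\<^sub>m n) (B * E) (0\<^sub>m k n) (1\<^sub>m k) *
      four_block_mat (A - B * E * C) (0\<^sub>m n k) C D"
    unfolding mult_four_block_mat[OF one_carrier_mat BE zero_carrier_mat one_carrier_mat
        S zero_carrier_mat C D]
    using left_mult_one_mat[OF S] left_mult_zero_mat[OF S] right_mult_zero_mat[OF BE]
      left_mult_one_mat[OF C] left_mult_one_mat[OF D] left_add_zero_mat[OF B]
      left_add_zero_mat[OF C] left_add_zero_mat[OF D]
    by (simp del: assoc_mult_mat)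
  moreover have "Determinant.det \<dots> = Determinant.det (four_block_mat (1\<^sub>m n) (B * E) (0\<^sub>m k n) (1\<^sub>m k)) *
      Determinant.det (four_block_mat (A - B * E * C) (0\<^sub>m n k) C D)"
    using A D S by (intro det_mult[of _ "n + k"] four_block_carrier_mat) auto
  moreover have "Determinant.det (four_block_mat (1\<^sub>m n) (B * E) (0\<^sub>m k n) (1\<^sub>m k)) = 1"
    by (subst det_four_block_mat_lower_left_zero[OF _ BE]) auto
  moreover have "Determinant.det (four_block_mat (A - B * E * C) (0\<^sub>m n k) C D) =
      Determinant.det (A - B * E * C) * Determinant.det D"
    by (rule det_four_block_mat_upper_right_zero[OF S _ C D]) simp
  ultimately show ?thesis
    by simp
qed

text \<open>The mirror image: \<open>C * E * A = C\<close> lets a unit lower triangular factor with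
  corner \<open>C * E\<close> produce the block \<open>C\<close>.\<close>

lemma det_four_block_mat_schur_upper_left:
  fixes A B C D E :: "'a :: idom mat"
  assumes A: "A \<in> carrier_mat n n" and B: "B \<in> carrier_mat n k"
    and C: "C \<in> carrier_mat k n" and D: "D \<in> carrier_mat k k"
    and E: "E \<in> carrier_mat n n" "E * A = 1\<^sub>m n"
  shows "Determinant.det (four_block_mat A B C D) =
    Determinant.det A * Determinant.det (D - C * E * B)"
proof -
  have CE: "C * E \<in> carrier_mat k n" and CEB: "C * E * B \<in> carrier_mat k k"
    using A B C E by auto
  have S: "D - C * E * B \<in> carrier_mat k k"
    using CEB by (rule minus_carrier_mat)
  have "C * E * A = C"
    using assoc_mult_mat[OF C E(1) A] C by (simp add: E(2))
  moreover have "C * E * B + (D - C * E * B) = D"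
    using minus_add_cancel_mat[OF D CEB] comm_add_mat[OF CEB S] by simp
  ultimately have "four_block_mat A B C D =
      four_block_mat (1\<^sub>m n) (0\<^sub>m n k) (C * E) (1\<^sub>m k) *
      four_block_mat A B (0\<^sub>m k n) (D - C * E * B)"
    unfolding mult_four_block_mat[OF one_carrier_mat zero_carrier_mat CE one_carrier_mat
        A B zero_carrier_mat S]
    using left_mult_one_mat[OF A] left_mult_one_mat[OF B] left_mult_one_mat[OF S]
      left_mult_zero_mat[OF S] right_add_zero_mat[OF A] right_add_zero_mat[OF B]
      right_add_zero_mat[OF C]
    by (simp del: assoc_mult_mat)
  moreover have "Determinant.det \<dots> = Determinant.det (four_block_mat (1\<^sub>m n) (0\<^sub>m n k) (C * E) (1\<^sub>m k)) *
      Determinant.det (four_block_mat A B (0\<^sub>m k n) (D - C * E * B))"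
    using A D S by (intro det_mult[of _ "n + k"] four_block_carrier_mat) auto
  moreover have "Determinant.det (four_block_mat (1\<^sub>m n) (0\<^sub>m n k) (C * E) (1\<^sub>m k)) = 1"
    by (subst det_four_block_mat_upper_right_zero[OF _ _ CE]) auto
  moreover have "Determinant.det (four_block_mat A B (0\<^sub>m k n) (D - C * E * B)) =
      Determinant.det A * Determinant.det (D - C * E * B)"
    by (rule det_four_block_mat_lower_left_zero[OF A B _ S]) simp
  ultimately show ?thesis
    by simp
qed

text \<open>The last row and column form blocks of width one, so the block formula becomes an
  entrywise recursion suited to induction on the dimension.\<close>

lemma det_Suc_schur:
  fixes A :: "'a :: field mat"
  assumes A: "A \<in> carrier_mat (Suc n) (Suc n)" and nz: "A $$ (n, n) \<noteq> 0"
  shows "Determinant.det A = A $$ (n, n) *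
    Determinant.det (mat n n (\<lambda>(i, j). A $$ (i, j) - A $$ (i, n) * A $$ (n, j) / A $$ (n, n)))"
proof -
  define B V W D E where
    "B = mat n n (\<lambda>(i, j). A $$ (i, j))" and "V = mat n 1 (\<lambda>(i, j). A $$ (i, n))" and
    "W = mat 1 n (\<lambda>(i, j). A $$ (n, j))" and "D = mat 1 1 (\<lambda>_. A $$ (n, n))" and
    "E = mat 1 1 (\<lambda>_. 1 / A $$ (n, n))"
  have carr: "B \<in> carrier_mat n n" "V \<in> carrier_mat n 1" "W \<in> carrier_mat 1 n"
      "D \<in> carrier_mat 1 1" "E \<in> carrier_mat 1 1"
    by (auto simp: B_def V_def W_def D_def E_def)
  have "A = four_block_mat B V W D"
    using A by (intro eq_matI)
      (auto simp: B_def V_def W_def D_def four_block_mat_def Let_def less_Suc_eq)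
  moreover have "E * D = 1\<^sub>m 1"
    using nz by (intro eq_matI) (auto simp: E_def D_def scalar_prod_def)
  moreover have "B - V * E * W =
      mat n n (\<lambda>(i, j). A $$ (i, j) - A $$ (i, n) * A $$ (n, j) / A $$ (n, n))"
    by (intro eq_matI) (auto simp: B_def V_def W_def E_def scalar_prod_def)
  moreover have "Determinant.det D = A $$ (n, n)"
    by (subst det_single) (auto simp: D_def)
  ultimately show ?thesis
    using det_four_block_mat_schur_lower_right[OF carr] by simp
qed

text \<open>Both sides are Schur-complement evaluations of the determinant of \<open>[[Q, F], [- G, T]]\<close>.\<close>

lemma det_add_mult_mult:
  fixes Q F G T :: "'a :: field mat"
  assumes Q: "Q \<in> carrier_mat n n" and F: "F \<in> carrier_mat n k"
    and G: "G \<in> carrier_mat k n" and T: "T \<in> carrier_mat k k"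
    and Q': "Q' \<in> carrier_mat n n" "Q' * Q = 1\<^sub>m n"
    and T': "T' \<in> carrier_mat k k" "T' * T = 1\<^sub>m k"
  shows "Determinant.det (F * T' * G + Q) * Determinant.det T =
    Determinant.det Q * Determinant.det (T + G * Q' * F)"
proof -
  have G': "- G \<in> carrier_mat k n"
    using G by auto
  have carr: "F * T' \<in> carrier_mat n k" "G * Q' \<in> carrier_mat k n" 
    "F * T' * G \<in> carrier_mat n n" "G * Q' * F \<in> carrier_mat k k"
    using assms by auto
  have "F * T' * - G = - (F * T' * G)" "- G * Q' * F = - (G * Q' * F)"
    using uminus_mult_right_mat[of "F * T'" G] uminus_mult_left_mat[of G Q']
      uminus_mult_left_mat[of "G * Q'" F] carrier_matD[OF F] carrier_matD[OF G]
      carrier_matD[OF Q'(1)] carrier_matD[OF T'(1)] by simp_all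
  \<comment> \<open>The sign in the block \<open>- G\<close> turns both Schur complements, which are
    differences, into sums.\<close>
  then have "Q - F * T' * - G = F * T' * G + Q" "T - - G * Q' * F = T + G * Q' * F"
    using minus_add_uminus_mat[OF Q, of "- (F * T' * G)"] comm_add_mat[OF Q carr(3)]
      minus_add_uminus_mat[OF T, of "- (G * Q' * F)"] carr(3,4)
    by (simp_all only: uminus_uminus_mat uminus_carrier_iff_mat)
  then show ?thesis
    using det_four_block_mat_schur_lower_right[OF Q F G' T T']
      det_four_block_mat_schur_upper_left[OF Q F G' T Q'] by simp
qed

section \<open>Positive definite matrices, inverses and congruence\<close>

lemma sym_pos_defD:
  assumes "sym_pos_def n P"
  shows "P \<in> carrier_mat n n" "transpose_mat P = P"
    "\<And>v. v \<in> carrier_vec n \<Longrightarrow> v \<noteq> 0\<^sub>v n \<Longrightarrow> 0 < scalar_prod v (P *\<^sub>v v)"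
  using assms by (auto simp: sym_pos_def_def)

lemma sym_pos_def_ge_0:
  assumes P: "sym_pos_def n P" and v: "v \<in> carrier_vec n"
  shows "0 \<le> scalar_prod v (P *\<^sub>v v)"
proof (cases "v = 0\<^sub>v n")
  case True
  then show ?thesis
    using sym_pos_defD(1)[OF P] by simp
next
  case False
  then show ?thesis
    using sym_pos_defD(3)[OF P v] by simp
qed

lemma sym_pos_def_det_nonzero:
  assumes P: "sym_pos_def n P"
  shows "Determinant.det P \<noteq> 0"
proof
  assume "Determinant.det P = 0"
  then obtain v where "v \<in> carrier_vec n" "v \<noteq> 0\<^sub>v n" "P *\<^sub>v v = 0\<^sub>v n"
    using det_0_iff_vec_prod_zero[OF sym_pos_defD(1)[OF P]] by auto
  then show False
    using sym_pos_defD(3)[OF P, of v] by simp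
qed

text \<open>\<open>mat_inverse\<close> is option-valued; the nonzero determinant excludes
  \<open>None\<close>, so \<open>the\<close> returns a genuine two-sided inverse.\<close>

lemma sym_pos_def_mat_inverse:
  assumes P: "sym_pos_def n P"
  shows "the (mat_inverse P) \<in> carrier_mat n n"
    "P * the (mat_inverse P) = 1\<^sub>m n" "the (mat_inverse P) * P = 1\<^sub>m n"
proof -
  have "P \<in> Units (ring_mat TYPE(real) n ())"
    using det_non_zero_imp_unit[OF sym_pos_defD(1) sym_pos_def_det_nonzero, OF P P] .
  then obtain B where "mat_inverse P = Some B"
    using mat_inverse(1)[OF sym_pos_defD(1)[OF P], of "()"] by (cases "mat_inverse P") auto
  then show "the (mat_inverse P) \<in> carrier_mat n n"
    "P * the (mat_inverse P) = 1\<^sub>m n" "the (mat_inverse P) * P = 1\<^sub>m n"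
    using mat_inverse(2)[OF sym_pos_defD(1)[OF P]] by auto
qed

lemma det_mat_inverse:
  assumes P: "sym_pos_def n P"
  shows "Determinant.det (the (mat_inverse P)) = 1 / Determinant.det P"
proof -
  have "Determinant.det P * Determinant.det (the (mat_inverse P)) = 1"
    using det_mult[OF sym_pos_defD(1)[OF P] sym_pos_def_mat_inverse(1)[OF P]]
      sym_pos_def_mat_inverse(2)[OF P] by simp
  then show ?thesis
    using sym_pos_def_det_nonzero[OF P] by (simp add: field_simps)
qed

lemma sym_pos_def_mult_mat_inverse_vec:
  assumes "sym_pos_def n P" "v \<in> carrier_vec n"
  shows "P *\<^sub>v (the (mat_inverse P) *\<^sub>v v) = v" "the (mat_inverse P) *\<^sub>v (P *\<^sub>v v) = v"
  using assms sym_pos_def_mat_inverse[OF assms(1)] sym_pos_defD(1)[OF assms(1)]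
  by (metis assoc_mult_mat_vec one_mult_mat_vec)+

lemma scalar_prod_sym_mat:
  fixes A :: "'a :: comm_semiring_0 mat"
  assumes "A \<in> carrier_mat n n" "transpose_mat A = A" "v \<in> carrier_vec n" "w \<in> carrier_vec n"
  shows "scalar_prod v (A *\<^sub>v w) = scalar_prod w (A *\<^sub>v v)"
  using transpose_vec_mult_scalar[OF assms(1,4,3)] assms
    comm_scalar_prod[of "A *\<^sub>v v" n w] by simp

text \<open>With w = P^-1 v the form of the inverse at v is the form of \<open>P\<close> at w, and w
  is nonzero because \<open>P\<close> maps it to v. Symmetry is uniqueness of inverses: the
  transposed inverse is also a left inverse of the symmetric \<open>P\<close>.\<close>

lemma sym_pos_def_inverse:
  assumes P: "sym_pos_def n P"
  shows "sym_pos_def n (the (mat_inverse P))"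
  unfolding sym_pos_def_def
proof (intro conjI ballI impI)
  let ?I = "the (mat_inverse P)"
  note I = sym_pos_def_mat_inverse[OF P] and PD = sym_pos_defD[OF P]
  show "?I \<in> carrier_mat n n"
    by (fact I)
  have "transpose_mat ?I * P = 1\<^sub>m n"
    using transpose_mult[OF PD(1) I(1)] I(2) PD(2) by simp
  then show "transpose_mat ?I = ?I"
    using assoc_mult_mat[of "transpose_mat ?I" n n P n ?I n] I PD(1) by simp
  fix v :: rvec assume v: "v \<in> carrier_vec n" "v \<noteq> 0\<^sub>v n"
  have Iv: "?I *\<^sub>v v \<in> carrier_vec n"
    using I(1) v(1) by simp
  have PI: "P *\<^sub>v (?I *\<^sub>v v) = v"
    by (rule sym_pos_def_mult_mat_inverse_vec(1)[OF P v(1)])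
  moreover have "P *\<^sub>v 0\<^sub>v n = 0\<^sub>v n"
    using PD(1) by (intro eq_vecI) auto
  ultimately have "?I *\<^sub>v v \<noteq> 0\<^sub>v n"
    using v(2) by metis
  then have "0 < scalar_prod (?I *\<^sub>v v) (P *\<^sub>v (?I *\<^sub>v v))"
    by (rule PD(3)[OF Iv])
  then show "0 < scalar_prod v (?I *\<^sub>v v)"
    using comm_scalar_prod[OF Iv v(1)] by (simp add: PI)
qed

lemma scalar_prod_congruence:
  fixes F P :: "'a :: comm_semiring_0 mat"
  assumes F: "F \<in> carrier_mat n k" and P: "P \<in> carrier_mat k k"
    and v: "v \<in> carrier_vec n" and w: "w \<in> carrier_vec n"
  shows "scalar_prod v ((F * P * transpose_mat F) *\<^sub>v w) =
    scalar_prod (transpose_mat F *\<^sub>v v) (P *\<^sub>v (transpose_mat F *\<^sub>v w))"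
proof -
  have "(F * P * transpose_mat F) *\<^sub>v w = F *\<^sub>v (P *\<^sub>v (transpose_mat F *\<^sub>v w))"
    using assms by (simp add: assoc_mult_mat_vec[of _ n k _ n] assoc_mult_mat_vec[of F n k P k])
  then show ?thesis
    using transpose_vec_mult_scalar[OF F _ v, of "P *\<^sub>v (transpose_mat F *\<^sub>v w)"] assms by simp
qed

text \<open>Strictness comes from \<open>Q\<close>: the transpose of \<open>F\<close> may have a
  kernel, so the first summand is merely nonnegative. The lemma serves twice, for the predicted
  covariance and, with the transpose of \<open>F\<close> and the two inverses, for the precision of
  the old state.\<close>

lemma sym_pos_def_congruence_add:
  assumes F: "F \<in> carrier_mat n k" and P: "sym_pos_def k P" and Q: "sym_pos_def n Q"
  shows "sym_pos_def n (F * P * transpose_mat F + Q)"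
  unfolding sym_pos_def_def
proof (intro conjI ballI impI)
  note PD = sym_pos_defD[OF P] and QD = sym_pos_defD[OF Q]
  have FP: "F * P \<in> carrier_mat n k" and FPF: "F * P * transpose_mat F \<in> carrier_mat n n"
    using F PD(1) by auto
  show "F * P * transpose_mat F + Q \<in> carrier_mat n n"
    using FPF QD(1) by auto
  have "transpose_mat (F * P * transpose_mat F) = F * P * transpose_mat F"
    using transpose_mult[OF FP, of "transpose_mat F" n] transpose_mult[OF F PD(1)] PD F
      assoc_mult_mat[OF F PD(1), of "transpose_mat F" n] by simp
  then show "transpose_mat (F * P * transpose_mat F + Q) = F * P * transpose_mat F + Q"
    using transpose_add[OF FPF QD(1)] QD(2) by simp
  fix v :: rvec assume v: "v \<in> carrier_vec n" "v \<noteq> 0\<^sub>v n"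
  have "scalar_prod v ((F * P * transpose_mat F + Q) *\<^sub>v v) =
      scalar_prod (transpose_mat F *\<^sub>v v) (P *\<^sub>v (transpose_mat F *\<^sub>v v)) + scalar_prod v (Q *\<^sub>v v)"
    unfolding add_mult_distrib_mat_vec[OF FPF QD(1) v(1)]
    using scalar_prod_add_distrib[OF v(1) mult_mat_vec_carrier[OF FPF v(1)] mult_mat_vec_carrier[OF QD(1) v(1)]]
      scalar_prod_congruence[OF F PD(1) v(1) v(1)] by (simp only:)
  then show "0 < scalar_prod v ((F * P * transpose_mat F + Q) *\<^sub>v v)"
    using sym_pos_def_ge_0[OF P, of "transpose_mat F *\<^sub>v v"] QD(3)[OF v] F v(1) by simp
qed

section \<open>Splitting off the last coordinate of a quadratic form\<close>

lemma scalar_prod_mult_mat_vec_sum: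
  assumes "A \<in> carrier_mat n n" "x \<in> carrier_vec n"
  shows "scalar_prod x (A *\<^sub>v x) =
    (\<Sum>i<n. \<Sum>j<n. vec_index x i * (A $$ (i, j)) * vec_index x j)"
  using assms
  by (auto simp: scalar_prod_def sum_distrib_left mult.assoc atLeast0LessThan intro!: sum.cong)

text \<open>For positive definite \<open>A\<close> this is the matrix of the form that remains after
  minimising over the last coordinate. Indices start at zero, so \<open>(n, n)\<close> is the last
  diagonal entry in dimension \<open>Suc n\<close>.\<close>

definition schur_last :: "nat \<Rightarrow> rmat \<Rightarrow> rmat" where
  "schur_last n A = mat n n (\<lambda>(i, j). A $$ (i, j) - A $$ (i, n) * A $$ (n, j) / A $$ (n, n))"

text \<open>Completing the square in \<open>y n\<close> leaves a correction -u^2/d, which is exactly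
  the difference between the leading block and the Schur complement. One function \<open>y\<close>
  supplies both vectors, so truncation just shortens the length, as for points of
  \<open>PiM\<close>.\<close>

lemma quadratic_form_schur_last:
  fixes A :: rmat and y :: "nat \<Rightarrow> real"
  assumes A: "A \<in> carrier_mat (Suc n) (Suc n)" and sym: "transpose_mat A = A"
    and nz: "A $$ (n, n) \<noteq> 0"
  shows "scalar_prod (Matrix.vec (Suc n) y) (A *\<^sub>v Matrix.vec (Suc n) y) =
    scalar_prod (Matrix.vec n y) (schur_last n A *\<^sub>v Matrix.vec n y) +
    A $$ (n, n) * (y n + (\<Sum>j<n. A $$ (n, j) * y j) / A $$ (n, n))\<^sup>2"
proof -
  define d u where "d = A $$ (n, n)" and "u = (\<Sum>j<n. A $$ (n, j) * y j)"
  have sym': "A $$ (i, n) = A $$ (n, i)" if "i < n" for i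
    using A that arg_cong[OF sym, of "\<lambda>M. M $$ (n, i)"] by simp
  have "scalar_prod (Matrix.vec (Suc n) y) (A *\<^sub>v Matrix.vec (Suc n) y) =
      (\<Sum>i<n. \<Sum>j<n. y i * A $$ (i, j) * y j) + 2 * y n * u + d * (y n)\<^sup>2"
    using A by (subst scalar_prod_mult_mat_vec_sum[of _ "Suc n"])
      (auto simp: sum.distrib u_def d_def sum_distrib_left sym' algebra_simps power2_eq_square)
  moreover have "scalar_prod (Matrix.vec n y) (schur_last n A *\<^sub>v Matrix.vec n y) =
      (\<Sum>i<n. \<Sum>j<n. y i * A $$ (i, j) * y j) - u * u / d"
  proof -
    have "u * u / d = (\<Sum>i<n. \<Sum>j<n. y i * (A $$ (i, n) * A $$ (n, j) / d) * y j)"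
      unfolding u_def sum_product sum_divide_distrib by (auto intro!: sum.cong simp: sym')
    then show ?thesis
      by (subst scalar_prod_mult_mat_vec_sum[of _ n])
        (auto simp: schur_last_def d_def algebra_simps sum_subtractf)
  qed
  moreover have "d * (y n + u / d)\<^sup>2 = d * (y n)\<^sup>2 + 2 * y n * u + u * u / d"
    using nz by (simp add: d_def[symmetric] power2_eq_square field_simps)
  ultimately show ?thesis
    by (simp add: d_def[symmetric] u_def[symmetric])
qed

text \<open>The diagonal entry is the form at the last unit vector. For the complement, a vector is
  extended by the last coordinate that minimises the form of \<open>A\<close>.\<close>

lemma sym_pos_def_schur_last:
  assumes A: "sym_pos_def (Suc n) A"
  shows "0 < A $$ (n, n)" "sym_pos_def n (schur_last n A)"
proof -
  have carr: "A \<in> carrier_mat (Suc n) (Suc n)" and sym: "transpose_mat A = A"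
    and pos: "\<And>v. v \<in> carrier_vec (Suc n) \<Longrightarrow> v \<noteq> 0\<^sub>v (Suc n) \<Longrightarrow> 0 < scalar_prod v (A *\<^sub>v v)"
    using A by (auto simp: sym_pos_def_def)
  have "unit_vec (Suc n) n \<noteq> (0\<^sub>v (Suc n) :: rvec)"
    by (metis index_unit_vec(1) index_zero_vec(1) lessI zero_neq_one)
  then have "0 < scalar_prod (unit_vec (Suc n) n) (A *\<^sub>v unit_vec (Suc n) n)"
    by (intro pos) auto
  also have "\<dots> = A $$ (n, n)"
    using carr by simp
  finally show d: "0 < A $$ (n, n)" .
  have sym': "A $$ (i, j) = A $$ (j, i)" if "i \<le> n" "j \<le> n" for i j
    using carr that arg_cong[OF sym, of "\<lambda>M. M $$ (j, i)"] by simp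
  show "sym_pos_def n (schur_last n A)"
    unfolding sym_pos_def_def
  proof (intro conjI ballI impI)
    show "schur_last n A \<in> carrier_mat n n"
      by (simp add: schur_last_def)
    show "transpose_mat (schur_last n A) = schur_last n A"
      by (rule eq_matI) (auto simp: schur_last_def sym' less_imp_le mult.commute)
    fix v :: rvec assume v: "v \<in> carrier_vec n" "v \<noteq> 0\<^sub>v n"
    \<comment> \<open>The value at \<open>n\<close> makes the square in
      \<open>quadratic_form_schur_last\<close> vanish.\<close>
    define y where "y i = (if i = n then - (\<Sum>j<n. A $$ (n, j) * vec_index v j) / A $$ (n, n)
      else vec_index v i)" for i
    have vy: "v = Matrix.vec n y"
      using v(1) by (auto simp: y_def)
    have "Matrix.vec (Suc n) y \<noteq> 0\<^sub>v (Suc n)"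
    proof
      assume "Matrix.vec (Suc n) y = 0\<^sub>v (Suc n)"
      then have "y i = 0" if "i < n" for i
        using that by (metis index_vec index_zero_vec(1) less_SucI)
      then show False
        using v(2) vy by (auto intro!: eq_vecI)
    qed
    then have "0 < scalar_prod (Matrix.vec (Suc n) y) (A *\<^sub>v Matrix.vec (Suc n) y)"
      by (intro pos) auto
    also have "\<dots> = scalar_prod v (schur_last n A *\<^sub>v v)"
      using d by (subst quadratic_form_schur_last[OF carr sym]) (auto simp: vy[symmetric], auto simp: y_def)
    finally show "0 < scalar_prod v (schur_last n A *\<^sub>v v)" .
  qed
qed

section \<open>The Gaussian integral in n dimensions\<close>

text \<open>The integrand is a rescaled normal density with standard deviation
  \<open>1 / sqrt d\<close>.\<close>

lemma nn_integral_gaussian_1: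
  assumes "0 < (d::real)"
  shows "(\<integral>\<^sup>+t. ennreal (exp (- (1 / 2) * (d * (t - a)\<^sup>2))) \<partial>lborel) = ennreal (sqrt (2 * pi / d))"
proof -
  have "exp (- (1 / 2) * (d * (t - a)\<^sup>2)) = sqrt (2 * pi / d) * normal_density a (1 / sqrt d) t" for t
    using assms by (simp add: normal_density_def power_divide real_sqrt_divide real_sqrt_mult field_simps)
  then have "(\<integral>\<^sup>+t. ennreal (exp (- (1 / 2) * (d * (t - a)\<^sup>2))) \<partial>lborel) =
      ennreal (sqrt (2 * pi / d)) * (\<integral>\<^sup>+t. ennreal (normal_density a (1 / sqrt d) t) \<partial>lborel)"
    using assms by (simp add: ennreal_mult nn_integral_cmult)
  also have "(\<integral>\<^sup>+t. ennreal (normal_density a (1 / sqrt d) t) \<partial>lborel) = 1"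
    using assms by (subst nn_integral_eq_integral) auto
  finally show ?thesis
    by simp
qed

lemma borel_measurable_quadratic_form_PiM:
  assumes "A \<in> carrier_mat n n"
  shows "(\<lambda>x. scalar_prod (Matrix.vec n (\<lambda>i. x i - c i)) (A *\<^sub>v Matrix.vec n (\<lambda>i. x i - c i)))
    \<in> borel_measurable (PiM {..<n} (\<lambda>_. lborel :: real measure))"
  by (subst scalar_prod_mult_mat_vec_sum[OF assms])
    (auto intro!: borel_measurable_sum borel_measurable_times borel_measurable_diff 
      measurable_component_singleton[of _ "{..<n}" "\<lambda>_. lborel :: real measure", simplified measurable_lborel1])

interpretation lborel_product: product_sigma_finite "\<lambda>_::nat. lborel :: real measure"
  by standard

text \<open>Positivity of the determinant is part of the induction because merging the square roots
  uses it. With \<open>nn_integral\<close>, iterated integration asks for measurability and no prior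
  integrability. The centre \<open>c\<close> is carried along and absorbed by each one-dimensional
  integral.\<close>

lemma gaussian_integral_PiM:
  fixes c :: "nat \<Rightarrow> real"
  assumes "sym_pos_def n A"
  shows "0 < Determinant.det A \<and>
    (\<integral>\<^sup>+x. ennreal (exp (- (1 / 2) *
        scalar_prod (Matrix.vec n (\<lambda>i. x i - c i)) (A *\<^sub>v Matrix.vec n (\<lambda>i. x i - c i))))
      \<partial>PiM {..<n} (\<lambda>_. lborel)) = ennreal (sqrt ((2 * pi) ^ n / Determinant.det A))"
  using assms
proof (induction n arbitrary: A)
  case 0
  then have "A \<in> carrier_mat 0 0"
    by (simp add: sym_pos_def_def)
  \<comment> \<open>Dimension zero: the product measure is a unit point mass, the form is an empty
    sum and the determinant is one, so both sides equal one.\<close>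
  then show ?case
    by (simp add: nn_integral_count_space_finite PiM_empty scalar_prod_def)
next
  case (Suc n)
  have carr: "A \<in> carrier_mat (Suc n) (Suc n)" and sym: "transpose_mat A = A"
    using Suc.prems by (auto simp: sym_pos_def_def)
  define d S where "d = A $$ (n, n)" and "S = schur_last n A"
  have d: "0 < d" and S: "sym_pos_def n S"
    using sym_pos_def_schur_last[OF Suc.prems] by (auto simp: d_def S_def)
  have det: "Determinant.det A = d * Determinant.det S" 
    using det_Suc_schur[OF carr] d by (simp add: d_def S_def schur_last_def)
  have detS: "0 < Determinant.det S"
    using Suc.IH[OF S] by simp
  let ?q = "\<lambda>n A x. scalar_prod (Matrix.vec n (\<lambda>i. x i - c i)) (A *\<^sub>v Matrix.vec n (\<lambda>i. x i - c i))"
  have "(\<integral>\<^sup>+x. ennreal (exp (- (1 / 2) * ?q (Suc n) A x)) \<partial>PiM {..<Suc n} (\<lambda>_. lborel)) =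
      (\<integral>\<^sup>+x. \<integral>\<^sup>+t. ennreal (exp (- (1 / 2) * ?q (Suc n) A (x(n := t)))) \<partial>lborel \<partial>PiM {..<n} (\<lambda>_. lborel))"
    unfolding lessThan_Suc
    using borel_measurable_quadratic_form_PiM[OF carr, unfolded lessThan_Suc]
    by (intro lborel_product.product_nn_integral_insert) auto
  also have "\<dots> = (\<integral>\<^sup>+x. ennreal (exp (- (1 / 2) * ?q n S x)) * ennreal (sqrt (2 * pi / d))
      \<partial>PiM {..<n} (\<lambda>_. lborel))"
  proof (rule nn_integral_cong)
    fix x :: "nat \<Rightarrow> real"
    \<comment> \<open>The centre of the inner Gaussian depends on \<open>x\<close>, but its integral
      over \<open>t\<close> does not; the inner integral is thus a constant factor.\<close>
    define a where "a = c n - (\<Sum>j<n. A $$ (n, j) * (x j - c j)) / d"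
    have "?q (Suc n) A (x(n := t)) = ?q n S x + d * (t - a)\<^sup>2" for t
    proof -
      have "Matrix.vec n (\<lambda>i. (x(n := t)) i - c i) = Matrix.vec n (\<lambda>i. x i - c i)"
        by (rule eq_vecI) auto
      then show ?thesis
        using d by (subst quadratic_form_schur_last[OF carr sym])
          (auto simp: d_def S_def a_def algebra_simps)
    qed
    then have "(\<integral>\<^sup>+t. ennreal (exp (- (1 / 2) * ?q (Suc n) A (x(n := t)))) \<partial>lborel) =
        (\<integral>\<^sup>+t. ennreal (exp (- (1 / 2) * ?q n S x)) * ennreal (exp (- (1 / 2) * (d * (t - a)\<^sup>2))) \<partial>lborel)"
      by (simp only: distrib_left exp_add ennreal_mult exp_ge_zero)
    also have "\<dots> = ennreal (exp (- (1 / 2) * ?q n S x)) * ennreal (sqrt (2 * pi / d))"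
      by (subst nn_integral_cmult) (simp_all only: nn_integral_gaussian_1[OF d], measurable)
    finally show "(\<integral>\<^sup>+t. ennreal (exp (- (1 / 2) * ?q (Suc n) A (x(n := t)))) \<partial>lborel) =
      ennreal (exp (- (1 / 2) * ?q n S x)) * ennreal (sqrt (2 * pi / d))" .
  qed
  also have "\<dots> = ennreal (sqrt ((2 * pi) ^ n / Determinant.det S)) * ennreal (sqrt (2 * pi / d))"
    using Suc.IH[OF S] borel_measurable_quadratic_form_PiM[of S n c] S
    by (subst nn_integral_multc) (auto simp: sym_pos_def_def)
  also have "\<dots> = ennreal (sqrt ((2 * pi) ^ n / Determinant.det S) * sqrt (2 * pi / d))"
    using d detS by (simp add: ennreal_mult)
  also have "sqrt ((2 * pi) ^ n / Determinant.det S) * sqrt (2 * pi / d) =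
      sqrt ((2 * pi) ^ Suc n / Determinant.det A)"
    by (simp add: det real_sqrt_mult[symmetric] mult.commute)
  finally show ?case
    using d detS by (simp add: det)
qed

text \<open>Transport along \<open>Matrix.vec n\<close> needs injectivity, which holds because
  points of the product space are extensional and hence determined by their first \<open>n\<close>
  values.\<close>

lemma nn_integral_lborel_vec:
  assumes "(\<lambda>y. g (Matrix.vec n y)) \<in> borel_measurable (PiM {..<n} (\<lambda>_. lborel))"
  shows "g \<in> borel_measurable (lborel_vec n)"
    "(\<integral>\<^sup>+x. g x \<partial>lborel_vec n) = (\<integral>\<^sup>+y. g (Matrix.vec n y) \<partial>PiM {..<n} (\<lambda>_. lborel))"
proof -
  have "inj_on (Matrix.vec n) (space (PiM {..<n} (\<lambda>_. lborel :: real measure)))"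
  proof (rule inj_onI)
    fix x y :: "nat \<Rightarrow> real"
    assume xy: "x \<in> space (PiM {..<n} (\<lambda>_. lborel))" "y \<in> space (PiM {..<n} (\<lambda>_. lborel))"
      and eq: "Matrix.vec n x = Matrix.vec n y"
    have "x i = y i" if "i < n" for i
      using that arg_cong[OF eq, of "\<lambda>v. vec_index v i"] by simp
    then show "x = y"
      using xy by (intro extensionalityI[of _ "{..<n}"]) (auto simp: space_PiM PiE_def)
  qed
  moreover show "g \<in> borel_measurable (lborel_vec n)"
    unfolding lborel_vec_def using assms by (rule measurable_embed_measure1)
  ultimately show "(\<integral>\<^sup>+x. g x \<partial>lborel_vec n) = (\<integral>\<^sup>+y. g (Matrix.vec n y) \<partial>PiM {..<n} (\<lambda>_. lborel))"
    unfolding lborel_vec_def by (rule nn_integral_embed_measure')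
qed

lemma sym_pos_def_det_pos: "sym_pos_def n A \<Longrightarrow> 0 < Determinant.det A"
  using gaussian_integral_PiM[of n A] by blast

lemma gaussian_integral_lborel_vec:
  assumes A: "sym_pos_def n A" and c: "c \<in> carrier_vec n"
  shows "has_bochner_integral (lborel_vec n)
    (\<lambda>x. exp (- (1 / 2) * scalar_prod (x - c) (A *\<^sub>v (x - c))))
    (sqrt ((2 * pi) ^ n / Determinant.det A))"
proof (rule has_bochner_integral_nn_integral)
  have eq: "Matrix.vec n y - c = Matrix.vec n (\<lambda>i. y i - vec_index c i)" for y
    using c by (intro eq_vecI) auto
  have meas: "(\<lambda>y. scalar_prod (Matrix.vec n y - c) (A *\<^sub>v (Matrix.vec n y - c)))
      \<in> borel_measurable (PiM {..<n} (\<lambda>_. lborel))"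
    unfolding eq using sym_pos_defD(1)[OF A] by (rule borel_measurable_quadratic_form_PiM)
  show "(\<integral>\<^sup>+x. ennreal (exp (- (1 / 2) * scalar_prod (x - c) (A *\<^sub>v (x - c)))) \<partial>lborel_vec n) =
      ennreal (sqrt ((2 * pi) ^ n / Determinant.det A))"
    using gaussian_integral_PiM[OF A, of "vec_index c"] meas
    by (subst nn_integral_lborel_vec(2)) (auto simp: eq)
  show "(\<lambda>x. exp (- (1 / 2) * scalar_prod (x - c) (A *\<^sub>v (x - c)))) \<in> borel_measurable (lborel_vec n)"
    unfolding lborel_vec_def using meas by (intro measurable_embed_measure1) auto
qed (use sym_pos_def_det_pos[OF A] in auto)

section \<open>Gaussian densities and their Chapman-Kolmogorov integral\<close>

lemma gaussian_nonneg: "sym_pos_def n P \<Longrightarrow> 0 \<le> gaussian x c P"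
  using sym_pos_def_det_pos[of n P] by (simp add: gaussian_def)

text \<open>The exponent contains the inverse of \<open>P\<close>, so the determinant in the
  Gaussian integral is \<open>1 / det P\<close>, and the value is precisely the normaliser in
  \<open>gaussian\<close>.\<close>

lemma has_bochner_integral_gaussian:
  assumes P: "sym_pos_def n P" and c: "c \<in> carrier_vec n"
  shows "has_bochner_integral (lborel_vec n) (\<lambda>x. gaussian x c P) 1"
proof -
  have "0 < (2 * pi) ^ n * Determinant.det P"
    using sym_pos_def_det_pos[OF P] by simp
  then have "sqrt ((2 * pi) ^ n * Determinant.det P) / sqrt ((2 * pi) ^ n * Determinant.det P) = 1"
    by (intro divide_self) (simp only: real_sqrt_eq_zero_cancel_iff less_imp_neq[symmetric] not_False_eq_True)
  then show ?thesis
    using has_bochner_integral_divide[OF gaussian_integral_lborel_vec[OF sym_pos_def_inverse[OF P] c],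
        of "sqrt ((2 * pi) ^ n * Determinant.det P)"] sym_pos_defD(1)[OF P]
    by (simp add: gaussian_def det_mat_inverse[OF P])
qed

text \<open>
  No inverse of \<open>P\<^sup>-\<^sup>1 + F\<^sup>T Q\<^sup>-\<^sup>1 F\<close> is needed: for \<open>z = (F P F\<^sup>T + Q) u\<close> the minimiser in \<open>w\<close> is
  \<open>c = P F\<^sup>T u\<close>, since \<open>z - F c = Q u\<close> and \<open>P\<^sup>-\<^sup>1 c = F\<^sup>T u\<close>.
\<close>

lemma complete_square:
  assumes F: "F \<in> carrier_mat n k" and P: "sym_pos_def k P" and Q: "sym_pos_def n Q"
    and u: "u \<in> carrier_vec n" and d: "d \<in> carrier_vec k"
    and z: "z = (F * P * transpose_mat F + Q) *\<^sub>v u"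
    and w: "w = d + P *\<^sub>v (transpose_mat F *\<^sub>v u)"
  defines "Pinv \<equiv> the (mat_inverse P)" and "Qinv \<equiv> the (mat_inverse Q)"
  shows "scalar_prod (z - F *\<^sub>v w) (Qinv *\<^sub>v (z - F *\<^sub>v w)) + scalar_prod w (Pinv *\<^sub>v w) =
    scalar_prod d ((Pinv + transpose_mat F * Qinv * F) *\<^sub>v d) + scalar_prod z u"
proof -
  note PD = sym_pos_defD[OF P] and QD = sym_pos_defD[OF Q]
    and PinvD = sym_pos_defD[OF sym_pos_def_inverse[OF P], folded Pinv_def]
    and QinvD = sym_pos_defD[OF sym_pos_def_inverse[OF Q], folded Qinv_def]
  define g c e where "g = transpose_mat F *\<^sub>v u" and "c = P *\<^sub>v g" and "e = F *\<^sub>v d"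
  have g: "g \<in> carrier_vec k" and c: "c \<in> carrier_vec k" and e: "e \<in> carrier_vec n"
    using F PD u d by (auto simp: g_def c_def e_def)
  have FP: "F * P \<in> carrier_mat n k" and FPF: "F * P * transpose_mat F \<in> carrier_mat n n"
    using F PD(1) by auto
  have Qu: "Q *\<^sub>v u \<in> carrier_vec n" and Fc: "F *\<^sub>v c \<in> carrier_vec n"
    and Qinve: "Qinv *\<^sub>v e \<in> carrier_vec n" and Pinvd: "Pinv *\<^sub>v d \<in> carrier_vec k"
    using F QD(1) QinvD(1) PinvD(1) u c e d by auto
  \<comment> \<open>Adjointness of \<open>F\<close> and its transpose: every pairing with
    \<open>g\<close> becomes a pairing with \<open>u\<close>.\<close>
  have ug: "scalar_prod x g = scalar_prod (F *\<^sub>v x) u" if "x \<in> carrier_vec k" for x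
    using transpose_vec_mult_scalar[OF F that u] comm_scalar_prod[OF that g]
      comm_scalar_prod[OF u, of "F *\<^sub>v x"] F that by (simp add: g_def)
  have Qinvu: "Qinv *\<^sub>v (Q *\<^sub>v u) = u" and Pinvc: "Pinv *\<^sub>v c = g"
    unfolding Qinv_def Pinv_def c_def
    using sym_pos_def_mult_mat_inverse_vec(2)[OF Q u] sym_pos_def_mult_mat_inverse_vec(2)[OF P g] .
  have "(F * P * transpose_mat F) *\<^sub>v u = F *\<^sub>v c"
    using assoc_mult_mat_vec[OF FP, of "transpose_mat F" n u] assoc_mult_mat_vec[OF F PD(1) g] F u
    by (simp add: g_def c_def)
  then have zeq: "z = F *\<^sub>v c + Q *\<^sub>v u"
    using add_mult_distrib_mat_vec[OF FPF QD(1) u] by (simp add: z)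
  have w: "w = d + c"
    by (simp add: w c_def g_def)
  have "F *\<^sub>v w = e + F *\<^sub>v c"
    using mult_add_distrib_mat_vec[OF F d c] by (simp add: w e_def)
  moreover have "p + q - (e + p) = q - e" if "p \<in> carrier_vec n" "q \<in> carrier_vec n" for p q
    using that e by (intro eq_vecI) auto
  ultimately have zw: "z - F *\<^sub>v w = Q *\<^sub>v u - e"
    using Fc Qu by (simp only: zeq)
  have "scalar_prod (z - F *\<^sub>v w) (Qinv *\<^sub>v (z - F *\<^sub>v w)) =
      scalar_prod (Q *\<^sub>v u) u - 2 * scalar_prod e u + scalar_prod e (Qinv *\<^sub>v e)"
  proof -
    have "Qinv *\<^sub>v (Q *\<^sub>v u - e) = u - Qinv *\<^sub>v e"
      using mult_minus_distrib_mat_vec[OF QinvD(1) Qu e] by (simp add: Qinvu)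
    moreover have "scalar_prod (Q *\<^sub>v u) (Qinv *\<^sub>v e) = scalar_prod e u"
      using scalar_prod_sym_mat[OF QinvD(1,2) Qu e] by (simp add: Qinvu)
    ultimately show ?thesis
      using minus_scalar_prod_distrib[OF Qu e, of "u - Qinv *\<^sub>v e"]
        scalar_prod_minus_distrib[OF Qu u Qinve] scalar_prod_minus_distrib[OF e u Qinve] u Qinve
      by (simp add: zw)
  qed
  moreover have "scalar_prod w (Pinv *\<^sub>v w) =
      scalar_prod d (Pinv *\<^sub>v d) + 2 * scalar_prod e u + scalar_prod (F *\<^sub>v c) u"
  proof -
    have "Pinv *\<^sub>v w = Pinv *\<^sub>v d + g"
      using mult_add_distrib_mat_vec[OF PinvD(1) d c] by (simp add: w Pinvc)
    moreover have "scalar_prod c (Pinv *\<^sub>v d) = scalar_prod d g"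
      using scalar_prod_sym_mat[OF PinvD(1,2) c d] by (simp add: Pinvc)
    ultimately show ?thesis
      using add_scalar_prod_distrib[OF d c, of "Pinv *\<^sub>v d + g"] Pinvd g
        scalar_prod_add_distrib[OF d Pinvd g] scalar_prod_add_distrib[OF c Pinvd g]
      by (simp add: w ug[OF d] ug[OF c] e_def)
  qed
  moreover have "scalar_prod z u = scalar_prod (F *\<^sub>v c) u + scalar_prod (Q *\<^sub>v u) u"
    using add_scalar_prod_distrib[OF Fc Qu u] by (simp add: zeq)
  moreover have "scalar_prod d ((Pinv + transpose_mat F * Qinv * F) *\<^sub>v d) =
      scalar_prod d (Pinv *\<^sub>v d) + scalar_prod e (Qinv *\<^sub>v e)"
  proof -
    have carr: "transpose_mat F * Qinv * F \<in> carrier_mat k k"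
      using F QinvD(1) by auto
    have "scalar_prod d ((transpose_mat F * Qinv * F) *\<^sub>v d) = scalar_prod e (Qinv *\<^sub>v e)"
      using scalar_prod_congruence[of "transpose_mat F" k n Qinv d d] F QinvD(1) d
      by (simp add: e_def del: assoc_mult_mat)
    then show ?thesis
      using add_mult_distrib_mat_vec[OF PinvD(1) carr d]
        scalar_prod_add_distrib[OF d Pinvd mult_mat_vec_carrier[OF carr d]] by (simp only:)
  qed
  \<comment> \<open>The cross terms \<open>2 * scalar_prod e u\<close> occur with opposite signs and
    cancel, which reflects that \<open>c\<close> is the minimiser.\<close>
  ultimately show ?thesis
    by linarith
qed

lemma gaussian_chapman_kolmogorov:
  assumes F: "F \<in> carrier_mat n k" and P: "sym_pos_def k P" and Q: "sym_pos_def n Q"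
    and b: "b \<in> carrier_vec n" and m: "m \<in> carrier_vec k" and x: "x \<in> carrier_vec n"
  shows "has_bochner_integral (lborel_vec k) (\<lambda>y. gaussian x (F *\<^sub>v y + b) Q * gaussian y m P)
    (gaussian x (F *\<^sub>v m + b) (F * P * transpose_mat F + Q))"
proof -
  define R Pinv Qinv where "R = F * P * transpose_mat F + Q"
    and "Pinv = the (mat_inverse P)" and "Qinv = the (mat_inverse Q)"
  define S where "S = Pinv + transpose_mat F * Qinv * F"
  note PD = sym_pos_defD[OF P] and QD = sym_pos_defD[OF Q]
    and PinvD = sym_pos_def_mat_inverse[OF P, folded Pinv_def]
    and QinvD = sym_pos_def_mat_inverse[OF Q, folded Qinv_def]
  have R: "sym_pos_def n R"
    unfolding R_def by (rule sym_pos_def_congruence_add[OF F P Q])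
  have Fm: "F *\<^sub>v m + b \<in> carrier_vec n"
    using F m b by simp
  have FQF: "transpose_mat F * Qinv * F \<in> carrier_mat k k"
    using F QinvD(1) by auto
  \<comment> \<open>The congruence lemma with the roles exchanged; it produces the summands in the
    opposite order, hence \<open>comm_add_mat\<close>.\<close>
  have S: "sym_pos_def k S"
    using sym_pos_def_congruence_add[of "transpose_mat F" k n Qinv Pinv] F
      sym_pos_def_inverse[OF P] sym_pos_def_inverse[OF Q] comm_add_mat[OF FQF PinvD(1)]
    by (simp add: S_def Pinv_def Qinv_def del: assoc_mult_mat)
  \<comment> \<open>In Kalman filter terms \<open>z\<close> is the innovation, \<open>c\<close> is
    the gain P F^T R^-1 applied to it, and \<open>m + c\<close> is the mean of the old state given
    \<open>x\<close>.\<close>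
  define z u c where "z = x - (F *\<^sub>v m + b)" and "u = the (mat_inverse R) *\<^sub>v z"
    and "c = P *\<^sub>v (transpose_mat F *\<^sub>v u)"
  have z: "z \<in> carrier_vec n"
    using x Fm by (simp add: z_def)
  have u: "u \<in> carrier_vec n"
    unfolding u_def by (rule mult_mat_vec_carrier[OF sym_pos_def_mat_inverse(1)[OF R] z])
  have c: "c \<in> carrier_vec k"
    using F u PD(1) by (simp add: c_def)
  have Ru: "z = R *\<^sub>v u"
    unfolding u_def by (simp add: sym_pos_def_mult_mat_inverse_vec(1)[OF R z])
  have dets: "0 < Determinant.det P" "0 < Determinant.det Q" "0 < Determinant.det R"
      "0 < Determinant.det S"
    using P Q R S by (auto intro: sym_pos_def_det_pos)
  \<comment> \<open>\<open>det_add_mult_mult\<close> with P^-1 as \<open>T\<close> and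
    \<open>P\<close> as its inverse gives det R / det P = det Q * det S.\<close>
  have det: "Determinant.det R = Determinant.det Q * Determinant.det P * Determinant.det S"
    using det_add_mult_mult[OF QD(1) F, of "transpose_mat F" Pinv Qinv P] F PD(1) PinvD QinvD
      det_mat_inverse[OF P, folded Pinv_def] dets by (simp add: R_def S_def field_simps del: assoc_mult_mat)
  \<comment> \<open>All factors free of \<open>y\<close>: the two normalisers and the exponential of
    the minimum value, where \<open>scalar_prod z u\<close> is the form of R^-1 at
    \<open>z\<close>.\<close>
  define K where "K = exp (- (1 / 2) * scalar_prod z u) /
    (sqrt ((2 * pi) ^ n * Determinant.det Q) * sqrt ((2 * pi) ^ k * Determinant.det P))"
  have eq: "gaussian x (F *\<^sub>v y + b) Q * gaussian y m P =
      K * exp (- (1 / 2) * scalar_prod (y - (m + c)) (S *\<^sub>v (y - (m + c))))"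
    if y: "y \<in> carrier_vec k" for y
  proof -
    have d: "y - (m + c) \<in> carrier_vec k"
      using y m c by simp
    have "y - m = y - (m + c) + c"
      using y m c by (auto intro!: eq_vecI)
    moreover have "x - (F *\<^sub>v y + b) = z - F *\<^sub>v (y - m)"
      using x y m b F mult_minus_distrib_mat_vec[OF F y m]
      by (auto simp: z_def intro!: eq_vecI)
    \<comment> \<open>\<open>complete_square\<close> with displacement \<open>w = y - m\<close> and
      deviation \<open>d = y - (m + c)\<close> from the minimiser.\<close>
    ultimately have "scalar_prod (x - (F *\<^sub>v y + b)) (Qinv *\<^sub>v (x - (F *\<^sub>v y + b))) +
        scalar_prod (y - m) (Pinv *\<^sub>v (y - m)) =
        scalar_prod (y - (m + c)) (S *\<^sub>v (y - (m + c))) + scalar_prod z u"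
      using complete_square[OF F P Q u d Ru[unfolded R_def] refl, folded Pinv_def Qinv_def c_def, folded S_def]
      by (simp only:)
    then show ?thesis
      using QD(1) PD(1)
      by (simp add: gaussian_def K_def Pinv_def[symmetric] Qinv_def[symmetric] exp_add[symmetric]
          del: exp_add)
  qed
  have "has_bochner_integral (lborel_vec k)
      (\<lambda>y. K * exp (- (1 / 2) * scalar_prod (y - (m + c)) (S *\<^sub>v (y - (m + c)))))
      (K * sqrt ((2 * pi) ^ k / Determinant.det S))"
    using gaussian_integral_lborel_vec[OF S, of "m + c"] m c
    by (intro has_bochner_integral_mult_right) simp
  moreover have "K * sqrt ((2 * pi) ^ k / Determinant.det S) = gaussian x (F *\<^sub>v m + b) R"
  proof -
    have "sqrt ((2 * pi) ^ n * Determinant.det R) * sqrt ((2 * pi) ^ k / Determinant.det S) =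
        sqrt ((2 * pi) ^ n * Determinant.det Q) * sqrt ((2 * pi) ^ k * Determinant.det P)"
      using dets by (simp add: det real_sqrt_mult[symmetric] field_simps)
    then show ?thesis
      using dets sym_pos_defD(1)[OF R]
      by (simp add: K_def gaussian_def z_def[symmetric] u_def[symmetric] field_simps)
  qed
  ultimately show ?thesis
    using eq by (subst has_bochner_integral_cong[OF refl _ refl])
      (auto simp: space_lborel_vec R_def[symmetric])
qed

section \<open>Prediction on the hybrid state space\<close>

theorem theorem5:
  fixes m :: nat and n :: "nat \<Rightarrow> nat"
    and f :: "nat \<times> rvec \<Rightarrow> real"
    and xbar :: "nat \<Rightarrow> rvec" and P :: "nat \<Rightarrow> rmat"
    and \<mu> :: "nat \<Rightarrow> nat pmf"
    and \<pi> :: "rvec \<Rightarrow> rvec \<Rightarrow> nat \<Rightarrow> nat \<Rightarrow> real"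
    and F Q :: "nat \<Rightarrow> nat \<Rightarrow> rmat" and b :: "nat \<Rightarrow> nat \<Rightarrow> rvec"
  assumes "m \<ge> 1"
    and "\<And>r. r \<in> {1..m} \<Longrightarrow> n r \<ge> 1"
    and "hybrid_density m n f"
    and "\<And>r. r \<in> {1..m} \<Longrightarrow> xbar r \<in> carrier_vec (n r)"
    and "\<And>r. r \<in> {1..m} \<Longrightarrow> sym_pos_def (n r) (P r)"
    and "\<And>r x. r \<in> {1..m} \<Longrightarrow> mode_marginal n f r > 0 \<Longrightarrow> x \<in> carrier_vec (n r) \<Longrightarrow>
           state_conditional n f x r = gaussian x (xbar r) (P r)"
    and "\<And>s. s \<in> {1..m} \<Longrightarrow> set_pmf (\<mu> s) \<subseteq> {1..m}"
    and "\<And>r s. r \<in> {1..m} \<Longrightarrow> s \<in> {1..m} \<Longrightarrow> F r s \<in> carrier_mat (n r) (n s)"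
    and "\<And>r s. r \<in> {1..m} \<Longrightarrow> s \<in> {1..m} \<Longrightarrow> b r s \<in> carrier_vec (n r)"
    and "\<And>r s. r \<in> {1..m} \<Longrightarrow> s \<in> {1..m} \<Longrightarrow> sym_pos_def (n r) (Q r s)"
    and "\<And>r s x y. r \<in> {1..m} \<Longrightarrow> s \<in> {1..m} \<Longrightarrow>
           x \<in> carrier_vec (n r) \<Longrightarrow> y \<in> carrier_vec (n s) \<Longrightarrow>
           \<pi> x y r s = gaussian x (F r s *\<^sub>v y + b r s) (Q r s)"
  shows "hybrid_density m n (predicted_density m n \<mu> \<pi> f) \<and>
    (\<forall>r\<in>{1..m}.
       (\<forall>x\<in>carrier_vec (n r).
          predicted_density m n \<mu> \<pi> f (r, x) =
            mode_marginal n (predicted_density m n \<mu> \<pi> f) r *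
            state_conditional n (predicted_density m n \<mu> \<pi> f) x r) \<and>
       (\<forall>s\<in>{1..m}. sym_pos_def (n r) (F r s * P s * transpose_mat (F r s) + Q r s)) \<and>
       (mode_marginal n (predicted_density m n \<mu> \<pi> f) r > 0 \<longrightarrow>
          (\<forall>x\<in>carrier_vec (n r).
             state_conditional n (predicted_density m n \<mu> \<pi> f) x r =
               (\<Sum>s=1..m.
                  (pmf (\<mu> s) r * mode_marginal n f s /
                    (\<Sum>s'=1..m. pmf (\<mu> s') r * mode_marginal n f s')) *
                  gaussian x (F r s *\<^sub>v xbar s + b r s)
                    (F r s * P s * transpose_mat (F r s) + Q r s)))) \<and>
       mode_marginal n (predicted_density m n \<mu> \<pi> f) r =
         (\<Sum>s=1..m. pmf (\<mu> s) r * mode_marginal n f s))"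
proof -
  define w where "w = mode_marginal n f"
  define R where "R r s = F r s * P s * transpose_mat (F r s) + Q r s" for r s
  define c where "c r s = F r s *\<^sub>v xbar s + b r s" for r s
  let ?p = "predicted_density m n \<mu> \<pi> f"
  have f_nonneg: "AE x in lborel_vec (n s). 0 \<le> f (s, x)"
    and f_int: "integrable (lborel_vec (n s)) (\<lambda>x. f (s, x))" if "s \<in> {1..m}" for s
    using assms(3) that
    by (auto simp: hybrid_density_def hybrid_space_def space_lborel_vec)
  have w_nonneg: "0 \<le> w s" if "s \<in> {1..m}" for s
    unfolding w_def mode_marginal_def by (rule integral_nonneg_AE[OF f_nonneg[OF that]])
  have w_sum: "(\<Sum>s=1..m. w s) = 1"
    using assms(3) by (simp add: hybrid_density_def hybrid_integral_def w_def mode_marginal_def)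
  have R: "sym_pos_def (n r) (R r s)" and c: "c r s \<in> carrier_vec (n r)"
    if "r \<in> {1..m}" "s \<in> {1..m}" for r s
    using sym_pos_def_congruence_add[OF assms(8)[OF that] assms(5)[OF that(2)] assms(10)[OF that]]
      assms(4)[OF that(2)] assms(8)[OF that] assms(9)[OF that]
    by (auto simp: R_def c_def)
  have component: "(\<integral>y. pmf (\<mu> s) r * \<pi> x y r s * f (s, y) \<partial>lborel_vec (n s)) =
      pmf (\<mu> s) r * w s * gaussian x (c r s) (R r s)"
    if r: "r \<in> {1..m}" and s: "s \<in> {1..m}" and x: "x \<in> carrier_vec (n r)" for r s x
  \<comment> \<open>The Gaussian form of the conditional is given for modes of positive marginal,
    hence the split.\<close>
  proof (cases "w s = 0")
    case True
    then have "AE y in lborel_vec (n s). f (s, y) = 0"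
      using integral_nonneg_eq_0_iff_AE[OF f_int[OF s] f_nonneg[OF s]]
      by (simp add: w_def mode_marginal_def)
    then have "AE y in lborel_vec (n s). pmf (\<mu> s) r * \<pi> x y r s * f (s, y) = 0"
      by (rule AE_mp) simp
    then show ?thesis
      using True by (simp add: integral_eq_zero_AE)
  next
    case False
    then have ws: "0 < w s"
      using w_nonneg[OF s] by simp
    have "(\<integral>y. pmf (\<mu> s) r * \<pi> x y r s * f (s, y) \<partial>lborel_vec (n s)) =
        (\<integral>y. (pmf (\<mu> s) r * w s) *
          (gaussian x (F r s *\<^sub>v y + b r s) (Q r s) * gaussian y (xbar s) (P s)) \<partial>lborel_vec (n s))"
    proof (rule Bochner_Integration.integral_cong)
      fix y assume "y \<in> space (lborel_vec (n s))"
      then have y: "y \<in> carrier_vec (n s)"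
        by (simp add: space_lborel_vec)
      have "f (s, y) = w s * gaussian y (xbar s) (P s)"
        using assms(6)[OF s _ y] ws by (simp add: state_conditional_def w_def field_simps)
      then show "pmf (\<mu> s) r * \<pi> x y r s * f (s, y) = (pmf (\<mu> s) r * w s) *
          (gaussian x (F r s *\<^sub>v y + b r s) (Q r s) * gaussian y (xbar s) (P s))"
        by (simp add: assms(11)[OF r s x y])
    qed simp
    also have "\<dots> = pmf (\<mu> s) r * w s * gaussian x (c r s) (R r s)"
      unfolding c_def R_def
      by (intro has_bochner_integral_integral_eq has_bochner_integral_mult_right
          gaussian_chapman_kolmogorov[OF assms(8)[OF r s] assms(5)[OF s] assms(10)[OF r s]
            assms(9)[OF r s] assms(4)[OF s] x])
    finally show ?thesis .
  qed
  \<comment> \<open>An identity at every point of the carrier, not merely almost everywhere; the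
    pointwise claims below rest on it.\<close>
  have pred: "?p (r, x) = (\<Sum>s=1..m. pmf (\<mu> s) r * w s * gaussian x (c r s) (R r s))"
    if "r \<in> {1..m}" "x \<in> carrier_vec (n r)" for r x
    unfolding predicted_density_def prod.case using component that by (intro sum.cong) auto
  have pred_integral: "has_bochner_integral (lborel_vec (n r)) (\<lambda>x. ?p (r, x)) (\<Sum>s=1..m. pmf (\<mu> s) r * w s)"
    if r: "r \<in> {1..m}" for r
  proof -
    have "has_bochner_integral (lborel_vec (n r))
        (\<lambda>x. \<Sum>s=1..m. pmf (\<mu> s) r * w s * gaussian x (c r s) (R r s))
        (\<Sum>s=1..m. pmf (\<mu> s) r * w s * 1)"
      by (intro has_bochner_integral_sum has_bochner_integral_mult_right
          has_bochner_integral_gaussian R c r)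
    then show ?thesis
      using pred[OF r]
      by (subst has_bochner_integral_cong[OF refl _ refl]) (auto simp: space_lborel_vec)
  qed
  have marginal: "mode_marginal n ?p r = (\<Sum>s=1..m. pmf (\<mu> s) r * w s)" if "r \<in> {1..m}" for r
    unfolding mode_marginal_def using pred_integral[OF that] by (rule has_bochner_integral_integral_eq)
  have density: "hybrid_density m n ?p"
    unfolding hybrid_density_def
  proof (intro conjI ballI)
    fix z assume "z \<in> hybrid_space m n"
    then obtain r x where z: "z = (r, x)" "r \<in> {1..m}" "x \<in> carrier_vec (n r)"
      by (auto simp: hybrid_space_def)
    then show "0 \<le> ?p z"
      by (auto simp: pred intro!: sum_nonneg mult_nonneg_nonneg w_nonneg gaussian_nonneg[OF R])
  next
    fix r assume "r \<in> {1..m}"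
    then show "integrable (lborel_vec (n r)) (\<lambda>x. ?p (r, x))"
      using pred_integral by (blast intro: has_bochner_integral_integrable integrable.intros)
  next
    have "hybrid_integral m n ?p = (\<Sum>r=1..m. \<Sum>s=1..m. pmf (\<mu> s) r * w s)"
      unfolding hybrid_integral_def using marginal by (simp add: mode_marginal_def)
    \<comment> \<open>After the exchange the inner sum is the total mass of \<open>\<mu> s\<close>,
      which is one because its support lies in \<open>{1..m}\<close>.\<close>
    also have "\<dots> = (\<Sum>s=1..m. (\<Sum>r=1..m. pmf (\<mu> s) r) * w s)"
      by (subst sum.swap) (simp add: sum_distrib_right)
    also have "\<dots> = (\<Sum>s=1..m. w s)"
      using sum_pmf_eq_1[OF finite_atLeastAtMost assms(7)] by simp
    finally show "hybrid_integral m n ?p = 1"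
      by (simp only: w_sum)
  qed
  have factor: "?p (r, x) = mode_marginal n ?p r * state_conditional n ?p x r"
    if r: "r \<in> {1..m}" and x: "x \<in> carrier_vec (n r)" for r x
  proof (cases "mode_marginal n ?p r = 0")
    case True
    \<comment> \<open>Here the conditional is a division by zero, so its product with the marginal
      is 0 and the predicted density itself must vanish: nonnegative weights with sum zero are all
      zero.\<close>
    then have "\<forall>s\<in>{1..m}. pmf (\<mu> s) r * w s = 0"
      using w_nonneg by (subst (asm) marginal[OF r], subst (asm) sum_nonneg_eq_0_iff) auto
    then show ?thesis
      unfolding pred[OF r x] True by (auto intro!: sum.neutral)
  qed (simp add: state_conditional_def)
  have mixture: "state_conditional n ?p x r =
      (\<Sum>s=1..m. (pmf (\<mu> s) r * w s / (\<Sum>s'=1..m. pmf (\<mu> s') r * w s')) *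
        gaussian x (c r s) (R r s))"
    if "r \<in> {1..m}" "x \<in> carrier_vec (n r)" for r x
    using that by (simp add: state_conditional_def pred marginal sum_divide_distrib)
  show ?thesis
    using density factor R mixture marginal unfolding w_def c_def R_def by blast
qed

end
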